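(* Let $P, Q$ be nonzero real numbers with $\Delta := P^2 - 4Q > 0$, and let $(U_n)_{n\in\mathbb{Z}}$ be the associated Lucas sequence of the first kind. Let $(a_n)_{n \geq 1}$ be a sequence of positive integers tending to infinity with $n$, and let $k$ be a positive integer. Then the series on the left below converges and $$\sum_{n = 1}^{+\infty} (-1)^n Q^{a_n} \frac{U_{a_{n + 2k} - a_n}}{U_{a_n} U_{a_{n + 2k}}} = - \sum_{n = 1}^{k} Q^{a_{2n - 1}} \frac{U_{a_{2n} - a_{2n - 1}}}{U_{a_{2n}} U_{a_{2n - 1}}}.$$
   Context: $P, Q$ are fixed nonzero real numbers with $\Delta := P^2 - 4Q > 0$. The Lucas sequence of the first kind $(U_n)_{n \in \mathbb{Z}}$ is defined by $U_0 = 0$, $U_1 = 1$ and $U_{n+2} = P U_{n+1} - Q U_n$ for all $n \in \mathbb{Z}$ (indices may be negative). Infinite sums $\sum_{n=1}^{+\infty}$ are understood as limits of partial sums (absolute convergence is not claimed). *)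

theory Defs
  imports Complex_Main
begin

definition lucas_first_kind :: "real \<Rightarrow> real \<Rightarrow> (int \<Rightarrow> real) \<Rightarrow> bool" where
  "lucas_first_kind P Q U \<longleftrightarrow>
     U 0 = 0 \<and> U 1 = 1 \<and> (\<forall>n. U (n + 2) = P * U (n + 1) - Q * U n)"

text \<open>For nonzero Q the recurrence can be run in both directions, so the predicate
  determines the two-sided sequence uniquely.\<close>

fun lucas_nat :: "real \<Rightarrow> real \<Rightarrow> nat \<Rightarrow> real" where
  "lucas_nat P Q 0 = 0"
| "lucas_nat P Q (Suc 0) = 1"
| "lucas_nat P Q (Suc (Suc n)) = P * lucas_nat P Q (Suc n) - Q * lucas_nat P Q n"

lemma lucas_first_kind_ex1:
  assumes "Q \<noteq> 0"
  shows "\<exists>!U. lucas_first_kind P Q U"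
proof (rule ex_ex1I)
  define U where "U = (\<lambda>n::int. if n \<ge> 0 then lucas_nat P Q (nat n)
                          else - lucas_nat P Q (nat (- n)) / Q ^ nat (- n))"
  have "U (n + 2) = P * U (n + 1) - Q * U n" for n
  proof -
    consider "n \<ge> 0" | "n = -1" | "n \<le> -2" by linarith
    then show ?thesis
    proof cases
      case 1
      then have "nat (n + 2) = Suc (Suc (nat n))" "nat (n + 1) = Suc (nat n)" by auto
      with 1 show ?thesis by (simp add: U_def)
    next
      case 2
      with assms show ?thesis by (simp add: U_def)
    next
      case 3
      define m where "m = nat (- n - 2)"
      have n: "n = - int m - 2" using 3 by (simp add: m_def)
      have e: "nat (- n) = Suc (Suc m)" "nat (- (n + 1)) = Suc m" "nat (- (n + 2)) = m"
        unfolding n by auto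
      have u0: "U n = - lucas_nat P Q (Suc (Suc m)) / Q ^ Suc (Suc m)"
        and u1: "U (n + 1) = - lucas_nat P Q (Suc m) / Q ^ Suc m"
        using e n by (auto simp: U_def)
      have u2: "U (n + 2) = - lucas_nat P Q m / Q ^ m"
        unfolding n by (simp add: U_def)
      show ?thesis unfolding u0 u1 u2 using assms by (simp add: field_simps)
    qed
  qed
  then have "lucas_first_kind P Q U" by (simp add: lucas_first_kind_def U_def)
  then show "\<exists>U. lucas_first_kind P Q U" by blast
next
  fix U V
  assume U: "lucas_first_kind P Q U" and V: "lucas_first_kind P Q V"
  have rU: "U (n + 2) = P * U (n + 1) - Q * U n"
    and rV: "V (n + 2) = P * V (n + 1) - Q * V n" for n
    using U V by (auto simp: lucas_first_kind_def)
  have pos: "U (int m) = V (int m) \<and> U (int m + 1) = V (int m + 1)" for m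
  proof (induction m)
    case 0
    then show ?case using U V by (simp add: lucas_first_kind_def)
  next
    case (Suc m)
    then show ?case using rU[of "int m"] rV[of "int m"] by (simp add: algebra_simps)
  qed
  have neg: "U (- int m) = V (- int m) \<and> U (1 - int m) = V (1 - int m)" for m
  proof (induction m)
    case 0
    then show ?case using U V by (simp add: lucas_first_kind_def)
  next
    case (Suc m)
    have i: "- int (Suc m) + 2 = 1 - int m" "- int (Suc m) + 1 = - int m"
      "1 - int (Suc m) = - int m" by auto
    have "Q * U (- int (Suc m)) = P * U (- int m) - U (1 - int m)"
      using rU[of "- int (Suc m)"] unfolding i by linarith
    also have "\<dots> = P * V (- int m) - V (1 - int m)" using Suc by simp
    also have "\<dots> = Q * V (- int (Suc m))"
      using rV[of "- int (Suc m)"] unfolding i by linarith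
    finally have "U (- int (Suc m)) = V (- int (Suc m))" using assms by simp
    then show ?case using Suc unfolding i by simp
  qed
  show "U = V"
  proof
    fix n
    show "U n = V n" using pos[of "nat n"] neg[of "nat (- n)"] by (cases "n \<ge> 0") auto
  qed
qed

end

theory Submission
  imports Defs
begin

text \<open>With \<open>r n = U (n + 1) / U n\<close>, d'Ocagne's identity says
  \<open>Q ^ n * U (m - n) / (U n * U m) = r n - r m\<close>. So the \<open>n\<close>-th term of the series is
  \<open>(- 1) ^ n * (r (a n) - r (a (n + 2 * k)))\<close>, and the partial sums telescope up to
  an alternating block of \<open>2 * k\<close> values of \<open>r\<close>. This block tends to \<open>0\<close>, because
  by Binet's formula \<open>r n\<close> tends to the dominant root of \<open>X\<^sup>2 - P X + Q\<close>.\<close>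

text \<open>The induction step uses the hypothesis at \<open>m - 1\<close>, hence
  \<open>arbitrary: m\<close>. The recurrence, run backwards at \<open>m - 1\<close> and forwards at
  \<open>n\<close>, then regroups the two products. As \<open>m\<close> is an integer, the case
  \<open>m < n\<close> is included.\<close>

lemma lucas_dOcagne:
  assumes "lucas_first_kind P Q U"
  shows "Q ^ n * U (m - int n) = U m * U (int n + 1) - U (m + 1) * U (int n)"
proof (induction n arbitrary: m)
  case 0
  then show ?case using assms by (simp add: lucas_first_kind_def)
next
  case (Suc n)
  have rec: "U (i + 2) = P * U (i + 1) - Q * U i" for i
    using assms by (simp add: lucas_first_kind_def)
  have "Q ^ Suc n * U (m - int (Suc n)) = Q * (Q ^ n * U ((m - 1) - int n))"
    by (simp add: algebra_simps)
  also have "\<dots> = (Q * U (m - 1)) * U (int n + 1) - Q * (U m * U (int n))"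
    unfolding Suc.IH by (simp add: algebra_simps)
  also have "Q * U (m - 1) = P * U m - U (m + 1)"
    using rec[of "m - 1"] by (simp add: algebra_simps)
  also have "(P * U m - U (m + 1)) * U (int n + 1) - Q * (U m * U (int n))
      = U m * U (int n + 2) - U (m + 1) * U (int n + 1)"
    unfolding rec[of "int n"] by (simp add: algebra_simps)
  finally show ?case by (simp add: add.commute)
qed

text \<open>Both sides satisfy the same second-order recurrence with equal values at 0 and 1, so the
  induction carries two consecutive indices.\<close>

lemma lucas_Binet:
  assumes "lucas_first_kind (\<alpha> + \<beta>) (\<alpha> * \<beta>) U"
  shows "(\<alpha> - \<beta>) * U (int n) = \<alpha> ^ n - \<beta> ^ n"
proof -
  have rec: "U (i + 2) = (\<alpha> + \<beta>) * U (i + 1) - \<alpha> * \<beta> * U i" for i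
    using assms by (simp add: lucas_first_kind_def)
  have "(\<alpha> - \<beta>) * U (int n) = \<alpha> ^ n - \<beta> ^ n \<and>
        (\<alpha> - \<beta>) * U (int n + 1) = \<alpha> ^ Suc n - \<beta> ^ Suc n"
  proof (induction n)
    case 0
    then show ?case using assms by (simp add: lucas_first_kind_def)
  next
    case (Suc n)
    have "(\<alpha> - \<beta>) * U (int n + 2)
        = (\<alpha> + \<beta>) * ((\<alpha> - \<beta>) * U (int n + 1)) - \<alpha> * \<beta> * ((\<alpha> - \<beta>) * U (int n))"
      unfolding rec by (simp add: algebra_simps)
    also have "\<dots> = \<alpha> ^ Suc (Suc n) - \<beta> ^ Suc (Suc n)"
      unfolding conjunct1[OF Suc.IH] conjunct2[OF Suc.IH] by (simp add: algebra_simps)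
    finally show ?case using Suc.IH by (simp add: add.commute)
  qed
  then show ?thesis ..
qed

lemma dominant_root_ex:
  fixes P Q :: real
  assumes "P \<noteq> 0" and "P\<^sup>2 - 4 * Q > 0"
  obtains \<alpha> \<beta> where "P = \<alpha> + \<beta>" "Q = \<alpha> * \<beta>" "\<bar>\<beta>\<bar> < \<bar>\<alpha>\<bar>"
proof -
  \<comment> \<open>The sign of \<open>P\<close> makes \<open>P * D\<close> positive. This product
    is the difference of the squares of the roots \<open>(P + D) / 2\<close> and
    \<open>(P - D) / 2\<close>, so the first one dominates.\<close>
  define D where "D = sgn P * sqrt (P\<^sup>2 - 4 * Q)"
  have "D\<^sup>2 = P\<^sup>2 - 4 * Q"
    using assms by (simp add: D_def power_mult_distrib sgn_if)
  then have prod: "Q = ((P + D) / 2) * ((P - D) / 2)"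
    by (simp add: field_simps power2_eq_square)
  have "P * D > 0"
    using assms by (simp add: D_def sgn_if zero_less_mult_iff)
  then have "((P - D) / 2)\<^sup>2 < ((P + D) / 2)\<^sup>2"
    by (simp add: field_simps power2_eq_square)
  then have "\<bar>(P - D) / 2\<bar> < \<bar>(P + D) / 2\<bar>"
    using abs_le_square_iff[of "(P + D) / 2" "(P - D) / 2"] by linarith
  then show thesis
    using that[of "(P + D) / 2" "(P - D) / 2"] prod by (simp add: field_simps)
qed

lemma lucas_nonzero_dominant:
  fixes \<alpha> \<beta> :: real
  assumes "lucas_first_kind (\<alpha> + \<beta>) (\<alpha> * \<beta>) U" and "\<bar>\<beta>\<bar> < \<bar>\<alpha>\<bar>" and "n > 0"
  shows "U (int n) \<noteq> 0"
proof
  assume "U (int n) = 0"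
  then have "\<alpha> ^ n = \<beta> ^ n"
    using lucas_Binet[OF assms(1), of n] by simp
  then have "\<bar>\<alpha>\<bar> ^ n = \<bar>\<beta>\<bar> ^ n"
    by (metis power_abs)
  then show False
    using power_strict_mono[OF assms(2) _ assms(3)] by simp
qed

text \<open>Dividing numerator and denominator of Binet's quotient by \<open>\<alpha> ^ n\<close>
  leaves only powers of \<open>\<beta> / \<alpha>\<close>, which tend to 0.\<close>

lemma lucas_ratio_tendsto:
  fixes \<alpha> \<beta> :: real
  assumes "lucas_first_kind (\<alpha> + \<beta>) (\<alpha> * \<beta>) U" and "\<bar>\<beta>\<bar> < \<bar>\<alpha>\<bar>"
  shows "(\<lambda>n. U (int n + 1) / U (int n)) \<longlonglongrightarrow> \<alpha>"
proof -
  define x where "x = \<beta> / \<alpha>"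
  have \<alpha>: "\<alpha> \<noteq> 0" and ne: "\<alpha> - \<beta> \<noteq> 0" using assms(2) by auto
  have "\<bar>x\<bar> < 1" using assms(2) \<alpha> by (simp add: x_def)
  then have lim: "(\<lambda>n. x ^ n) \<longlonglongrightarrow> 0" by (simp add: LIMSEQ_power_zero)
  \<comment> \<open>This includes \<open>n = 0\<close>: both denominators vanish there, and both
    quotients are 0 by convention.\<close>
  have "U (int n + 1) / U (int n) = (\<alpha> - \<beta> * x ^ n) / (1 - x ^ n)" for n
  proof -
    have "U (int n + 1) / U (int n) = ((\<alpha> - \<beta>) * U (int (Suc n))) / ((\<alpha> - \<beta>) * U (int n))"
      using ne by (simp add: add.commute)
    also have "\<dots> = (\<alpha> ^ Suc n - \<beta> ^ Suc n) / (\<alpha> ^ n - \<beta> ^ n)"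
      by (simp only: lucas_Binet[OF assms(1)])
    also have "\<dots> = (\<alpha> ^ n * (\<alpha> - \<beta> * x ^ n)) / (\<alpha> ^ n * (1 - x ^ n))"
      using \<alpha> by (simp add: x_def power_divide right_diff_distrib mult.commute)
    also have "\<dots> = (\<alpha> - \<beta> * x ^ n) / (1 - x ^ n)" using \<alpha> by simp
    finally show ?thesis .
  qed
  moreover have "(\<lambda>n. (\<alpha> - \<beta> * x ^ n) / (1 - x ^ n)) \<longlonglongrightarrow> (\<alpha> - \<beta> * 0) / (1 - 0)"
    by (intro tendsto_intros lim) simp
  ultimately show ?thesis by simp
qed

text \<open>Telescoping with stride \<open>m\<close>; for \<open>N < m\<close> the two blocks on the
  right overlap and the identity persists.\<close>

lemma sum_lessThan_diff_shift:
  fixes s :: "nat \<Rightarrow> 'a::ab_group_add"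
  shows "(\<Sum>i<N. s i - s (i + m)) = (\<Sum>i<m. s i) - (\<Sum>i<m. s (N + i))"
proof (induction N)
  case (Suc N)
  \<comment> \<open>A window of \<open>m + 1\<close> terms is split off at its first term here and
    at its last term next.\<close>
  have "s N + (\<Sum>i<m. s (Suc N + i)) = (\<Sum>i<Suc m. s (N + i))"
    by (subst sum.lessThan_Suc_shift) simp
  then have "s N - s (N + m) = (\<Sum>i<m. s (N + i)) - (\<Sum>i<m. s (Suc N + i))"
    by (simp add: algebra_simps)
  then show ?case by (simp add: Suc.IH)
qed simp

lemma sum_lessThan_double:
  fixes f :: "nat \<Rightarrow> 'a::comm_monoid_add"
  shows "(\<Sum>i<2 * k. f i) = (\<Sum>j<k. f (2 * j) + f (2 * j + 1))"
  by (induction k) (simp_all add: add.assoc)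

text \<open>The even shift \<open>2 * k\<close> preserves the sign, so the terms telescope. The
  remaining block pairs into \<open>k\<close> differences, each tending to
  \<open>L - L\<close>.\<close>

lemma alternating_diff_sums:
  fixes t :: "nat \<Rightarrow> real"
  assumes "t \<longlonglongrightarrow> L"
  shows "(\<lambda>i. (- 1) ^ i * (t i - t (i + 2 * k))) sums (\<Sum>j<k. t (2 * j) - t (2 * j + 1))"
proof -
  define s where "s i = (- 1) ^ i * t i" for i
  define d where "d N = (\<Sum>j<k. t (N + 2 * j) - t (N + (2 * j + 1)))" for N
  have term_eq: "(- 1) ^ i * (t i - t (i + 2 * k)) = s i - s (i + 2 * k)" for i
    by (simp add: s_def power_add right_diff_distrib)
  have block: "(\<Sum>i<2 * k. s (N + i)) = (- 1) ^ N * d N" for N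
    unfolding sum_lessThan_double d_def sum_distrib_left
    by (intro sum.cong) (simp_all add: s_def power_add algebra_simps)
  have "d \<longlonglongrightarrow> (\<Sum>j<k. L - L)"
    unfolding d_def by (intro tendsto_intros LIMSEQ_ignore_initial_segment assms)
  \<comment> \<open>The oscillating sign disappears on passing to absolute values.\<close>
  then have "(\<lambda>N. (- 1) ^ N * d N) \<longlonglongrightarrow> 0"
    by (intro tendsto_rabs_zero_cancel[where f = "\<lambda>N. (- 1) ^ N * d N"])
      (simp add: abs_mult power_abs tendsto_rabs_zero)
  then have "(\<lambda>N. (\<Sum>i<2 * k. s i) - (- 1) ^ N * d N) \<longlonglongrightarrow> (\<Sum>i<2 * k. s i) - 0"
    by (intro tendsto_intros)
  moreover have "(\<Sum>i<2 * k. s i) = (\<Sum>j<k. t (2 * j) - t (2 * j + 1))"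
    using block[of 0] by (simp add: d_def)
  ultimately show ?thesis
    by (simp add: sums_def term_eq sum_lessThan_diff_shift block)
qed

theorem corollary2p5:
  fixes P Q :: real and U :: "int \<Rightarrow> real" and a :: "nat \<Rightarrow> nat" and k :: nat
  assumes "P \<noteq> 0" and "Q \<noteq> 0" and "P\<^sup>2 - 4 * Q > 0"
    and "lucas_first_kind P Q U"
    and "\<forall>n\<ge>1. a n > 0"
    and "filterlim a at_top sequentially"
    and "k > 0"
  shows "(\<lambda>i. let n = i + 1 in
            (- 1) ^ n * Q ^ a n *
              (U (int (a (n + 2 * k)) - int (a n)) / (U (int (a n)) * U (int (a (n + 2 * k))))))
         sums
         (- (\<Sum>n = 1..k. Q ^ a (2 * n - 1) *
              (U (int (a (2 * n)) - int (a (2 * n - 1))) /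
                (U (int (a (2 * n))) * U (int (a (2 * n - 1)))))))"
proof -
  obtain \<alpha> \<beta> where roots: "P = \<alpha> + \<beta>" "Q = \<alpha> * \<beta>" "\<bar>\<beta>\<bar> < \<bar>\<alpha>\<bar>"
    using dominant_root_ex assms(1,3) by metis
  have luc: "lucas_first_kind (\<alpha> + \<beta>) (\<alpha> * \<beta>) U"
    using assms(4) roots by simp
  define r where "r n = U (int n + 1) / U (int n)" for n
  \<comment> \<open>Indices of \<open>a\<close> start at 1, those of \<open>t\<close> at 0. The sign
    \<open>(- 1) ^ (i + 1)\<close> thus becomes \<open>- ((- 1) ^ i)\<close>, the source of the
    minus sign in the result.\<close>
  define t where "t i = r (a (i + 1))" for i
  have "r \<longlonglongrightarrow> \<alpha>"
    unfolding r_def by (rule lucas_ratio_tendsto[OF luc roots(3)])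
  then have "(\<lambda>n. r (a n)) \<longlonglongrightarrow> \<alpha>"
    using assms(6) by (rule filterlim_compose)
  then have "t \<longlonglongrightarrow> \<alpha>"
    unfolding t_def by (rule LIMSEQ_ignore_initial_segment)
  then have sums: "(\<lambda>i. - ((- 1) ^ i * (t i - t (i + 2 * k)))) sums
      (- (\<Sum>j<k. t (2 * j) - t (2 * j + 1)))"
    by (intro sums_minus alternating_diff_sums)
  \<comment> \<open>Positive indices ensure that d'Ocagne's identity may be divided by
    \<open>U (int n) * U (int m)\<close>.\<close>
  have diff: "Q ^ n * (U (int m - int n) / (U (int n) * U (int m))) = r n - r m"
    if "n > 0" "m > 0" for n m
  proof -
    have "U (int n) \<noteq> 0" "U (int m) \<noteq> 0"
      using lucas_nonzero_dominant[OF luc roots(3)] that by auto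
    then show ?thesis
      using lucas_dOcagne[OF assms(4), of n "int m"] by (simp add: r_def field_simps)
  qed
  have "(let n = i + 1 in (- 1) ^ n * Q ^ a n *
          (U (int (a (n + 2 * k)) - int (a n)) / (U (int (a n)) * U (int (a (n + 2 * k))))))
      = - ((- 1) ^ i * (t i - t (i + 2 * k)))" for i
  proof -
    have "Q ^ a (i + 1) * (U (int (a (i + 1 + 2 * k)) - int (a (i + 1))) /
        (U (int (a (i + 1))) * U (int (a (i + 1 + 2 * k))))) = t i - t (i + 2 * k)"
      using diff[of "a (i + 1)" "a (i + 1 + 2 * k)"] assms(5) by (simp add: t_def)
    then show ?thesis
      by (simp only: Let_def mult.assoc) simp
  qed
  moreover have "(\<Sum>n = 1..k. Q ^ a (2 * n - 1) *
        (U (int (a (2 * n)) - int (a (2 * n - 1))) /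
          (U (int (a (2 * n))) * U (int (a (2 * n - 1))))))
      = (\<Sum>j<k. t (2 * j) - t (2 * j + 1))"
  \<comment> \<open>With \<open>j = n - 1\<close>, the values of \<open>t\<close> at
    \<open>2 * j\<close> and \<open>2 * j + 1\<close> belong to \<open>a (2 * n - 1)\<close> and
    \<open>a (2 * n)\<close>.\<close>
  proof (rule sum.reindex_bij_witness[of _ Suc "\<lambda>n. n - 1"])
    fix n assume "n \<in> {1..k}"
    then have "2 * (n - 1) + 1 = 2 * n - 1" "2 * (n - 1) + 1 + 1 = 2 * n"
      and "a (2 * n - 1) > 0" "a (2 * n) > 0"
      using assms(5) by auto
    then show "t (2 * (n - 1)) - t (2 * (n - 1) + 1) = Q ^ a (2 * n - 1) *
        (U (int (a (2 * n)) - int (a (2 * n - 1))) /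
          (U (int (a (2 * n))) * U (int (a (2 * n - 1)))))"
      using diff[of "a (2 * n - 1)" "a (2 * n)"] by (simp only: t_def mult.commute)
  qed auto
  ultimately show ?thesis
    using sums by (simp only:)
qed

end
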